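(* Let $0<\alpha<1$. The Crank–Nicholson finite difference scheme (S) described in the context is unconditionally stable. That is, for all positive integers $M,N$ (with $h=L/M$, $\tau=T/N$), if $(U_i^k)$ and $(\widetilde U_i^k)$ both satisfy the scheme (S) with the same data $f$ and $\psi$ and zero boundary values, but with possibly different initial values $(U_i^0)$ and $(\widetilde U_i^0)$, then $$\|U^k-\widetilde U^k\|_2\le \|U^0-\widetilde U^0\|_2,\qquad k=1,2,\ldots,N.$$
   Context: Fix $L,T>0$. The fractal mobile/immobile transport model is $$\frac{\partial u}{\partial t}+{}_0^{C}D_t^\alpha u=\frac{\partial^2 u}{\partial x^2}+f(x,t),\quad (x,t)\in[0,L]\times[0,T],$$ with $u(x,0)=\phi(x)$ for $0\le x\le L$ and $u(0,t)=u(L,t)=0$ for $t>0$, where ${}_0^{C}D_t^\alpha u(x,t)=\frac{1}{\Gamma(1-\alpha)}\int_0^t \frac{\partial u}{\partial s}(x,s)(t-s)^{-\alpha}ds$ is the Caputo derivative. Set $\psi(x)=\phi''(x)+f(x,0)$. Grid: $h=L/M$, $x_i=ih$ ($0\le i\le M$), $\tau=T/N$, $t_k=k\tau$ ($0\le k\le N$), $\psi_i=\psi(x_i)$, $f_i^{k+1/2}=f(x_i,(k+\tfrac12)\tau)$. Coefficients: $M_j=(j+1)^{2-\alpha}-j^{2-\alpha}$ for $j\ge0$; $G_{j+1}=M_{j+1}-M_j$ for $j\ge 0$; $\beta=\dfrac{\tau^{1-\alpha}}{\Gamma(3-\alpha)}$. Scheme (S): $U_0^k=U_M^k=0$ for all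 $k$, and for $1\le i\le M-1$, $k=0,1,\ldots,N-1$, $$-\frac{\tau}{2h^2}U_{i+1}^{k+1}+\Big(\frac{\tau}{h^2}+1+\beta\Big)U_i^{k+1}-\frac{\tau}{2h^2}U_{i-1}^{k+1}$$ $$=\frac{\tau}{2h^2}U_{i+1}^{k}+\Big(-\frac{\tau}{h^2}+1+\beta-\beta G_1\mathbf 1_{k\ge1}\Big)U_i^{k}+\frac{\tau}{2h^2}U_{i-1}^{k}+\beta\sum_{j=1}^{k-1}(G_{k-j}-G_{k-j+1})U_i^j+\beta G_kU_i^0\,\mathbf 1_{k\ge1}$$ $$\quad+\tau\beta M_k\psi_i+\tau f_i^{k+1/2}-\frac{\tau\psi_i[(k+\frac12)\tau]^{1-\alpha}}{\Gamma(2-\alpha)},$$ where $\mathbf 1_{k\ge1}$ is $1$ if $k\ge1$ and $0$ if $k=0$ (the corresponding terms are absent for $k=0$), and empty sums are $0$. Norm: for a grid function $V=(V_i)_{0\le i\le M}$ with $V_0=V_M=0$, $\|V\|_2=\big(\sum_{i=1}^{M-1}h|V_i|^2\big)^{1/2}$. *)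

theory Defs
  imports "HOL-Analysis.Analysis"
begin

definition coeff_M :: "real \<Rightarrow> nat \<Rightarrow> real" where
  "coeff_M \<alpha> j = (real j + 1) powr (2 - \<alpha>) - real j powr (2 - \<alpha>)"

(* Only the values at j \<ge> 1 are meaningful; the scheme never uses coeff_G \<alpha> 0
   with a nonzero factor. *)
definition coeff_G :: "real \<Rightarrow> nat \<Rightarrow> real" where
  "coeff_G \<alpha> j = coeff_M \<alpha> j - coeff_M \<alpha> (j - 1)"

definition coeff_beta :: "real \<Rightarrow> real \<Rightarrow> real" where
  "coeff_beta \<alpha> \<tau> = \<tau> powr (1 - \<alpha>) / Gamma (3 - \<alpha>)"

(* U k i is the value at time level k and spatial node i.  The source f x t and
   the function \<psi> (in the model: \<psi> x = \<phi>'' x + f x 0, for the initial datum \<phi>) are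
   given data of the scheme; the initial level U 0 is left free. *)
definition cn_scheme ::
  "real \<Rightarrow> real \<Rightarrow> real \<Rightarrow> nat \<Rightarrow> nat \<Rightarrow> (real \<Rightarrow> real \<Rightarrow> real) \<Rightarrow> (real \<Rightarrow> real)
    \<Rightarrow> (nat \<Rightarrow> nat \<Rightarrow> real) \<Rightarrow> bool" where
  "cn_scheme \<alpha> L T M N f \<psi> U \<longleftrightarrow>
    (let h = L / real M; \<tau> = T / real N; \<beta> = coeff_beta \<alpha> \<tau>;
         G = coeff_G \<alpha>; x = (\<lambda>i. real i * h)
     in (\<forall>k\<le>N. U k 0 = 0 \<and> U k M = 0) \<and>
        (\<forall>k<N. \<forall>i\<in>{1..M - 1}.
          - (\<tau> / (2 * h\<^sup>2)) * U (k + 1) (i + 1)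
            + (\<tau> / h\<^sup>2 + 1 + \<beta>) * U (k + 1) i
            - \<tau> / (2 * h\<^sup>2) * U (k + 1) (i - 1)
          = \<tau> / (2 * h\<^sup>2) * U k (i + 1)
            + (- (\<tau> / h\<^sup>2) + 1 + \<beta> - \<beta> * G 1 * of_bool (k \<ge> 1)) * U k i
            + \<tau> / (2 * h\<^sup>2) * U k (i - 1)
            + \<beta> * (\<Sum>j = 1..k - 1. (G (k - j) - G (k - j + 1)) * U j i)
            + \<beta> * G k * U 0 i * of_bool (k \<ge> 1)
            + \<tau> * \<beta> * coeff_M \<alpha> k * \<psi> (x i)
            + \<tau> * f (x i) ((real k + 1 / 2) * \<tau>)
            - \<tau> * \<psi> (x i) * ((real k + 1 / 2) * \<tau>) powr (1 - \<alpha>) / Gamma (2 - \<alpha>)))"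

definition grid_norm :: "real \<Rightarrow> nat \<Rightarrow> (nat \<Rightarrow> real) \<Rightarrow> real" where
  "grid_norm h M V = sqrt (\<Sum>i = 1..M - 1. h * \<bar>V i\<bar>\<^sup>2)"

end

theory Submission imports Defs begin

text \<open>Let E be the difference of the two solutions and d k = E (k + 1) - E k. Summation by
  parts in time turns the scheme into
  a 0 * d k + ... + a k * d 0 = \<mu> * laplacian (E (k + 1) + E k) with a 0 = 1 + \<beta> and
  a j = \<beta> * G j. Testing with the solution w k of the discrete Poisson problem
  - laplacian (w k) = d k makes the right-hand side telescope to \<mu> times the decrease of the
  squared norm of E. The left-hand side becomes the causal quadratic form of the kernel a,
  evaluated at the discrete gradients of the w k. This form is nonnegative because the sequence
  2 * a 0, a 1, a 2, ... is nonnegative, nonincreasing and convex.\<close>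

section \<open>Mean value tools\<close>

lemma real_mvt:
  fixes f f' :: "real \<Rightarrow> real"
  assumes "a < b" and "continuous_on {a..b} f"
    and der: "\<And>y. a < y \<Longrightarrow> y < b \<Longrightarrow> (f has_real_derivative f' y) (at y)"
  obtains z where "a < z" "z < b" "f b - f a = (b - a) * f' z"
proof -
  obtain l z where "a < z" "z < b" "(f has_real_derivative l) (at z)" "f b - f a = (b - a) * l"
    using MVT[OF assms(1,2)] der by (meson real_differentiable_def)
  then show thesis using DERIV_unique[OF _ der] that by blast
qed

text \<open>By the mean value theorem on both halves, the left slope is at most the right one. The
  derivative is asked for only in the open interval, so that for powers the interval may touch
  0.\<close>

lemma midpoint_le_of_mono_deriv:
  fixes f f' :: "real \<Rightarrow> real"
  assumes "h > 0" and "continuous_on {x - h..x + h} f"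
    and der: "\<And>y. x - h < y \<Longrightarrow> y < x + h \<Longrightarrow> (f has_real_derivative f' y) (at y)"
    and mono: "\<And>y z. x - h < y \<Longrightarrow> y \<le> z \<Longrightarrow> z < x + h \<Longrightarrow> f' y \<le> f' z"
  shows "2 * f x \<le> f (x + h) + f (x - h)"
proof -
  obtain y where y: "x - h < y" "y < x" "f x - f (x - h) = (x - (x - h)) * f' y"
    using real_mvt[of "x - h" x f f'] continuous_on_subset[OF assms(2), of "{x - h..x}"] der \<open>h > 0\<close>
    by auto
  obtain z where z: "x < z" "z < x + h" "f (x + h) - f x = (x + h - x) * f' z"
    using real_mvt[of x "x + h" f f'] continuous_on_subset[OF assms(2), of "{x..x + h}"] der \<open>h > 0\<close>
    by auto
  have "h * f' y \<le> h * f' z"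
    using mono[of y z] y z \<open>h > 0\<close> by simp
  moreover have "f x - f (x - h) = h * f' y" "f (x + h) - f x = h * f' z"
    using y z by simp_all
  ultimately show ?thesis by linarith
qed

section \<open>Second differences of powers\<close>

text \<open>A real variable replaces the index so that calculus applies: differentiation lowers the
  exponent by one and keeps the form. From \<open>p = 2 - \<alpha>\<close> one meets the exponents
  p, p - 1, p - 2, whose second differences alternate in sign.\<close>

definition powr_diff2 :: "real \<Rightarrow> real \<Rightarrow> real" where
  "powr_diff2 p x = (x + 1) powr p - 2 * x powr p + (x - 1) powr p"

lemma powr_diff2_has_derivative:
  assumes "x > 1"
  shows "(powr_diff2 p has_real_derivative p * powr_diff2 (p - 1) x) (at x)"
  unfolding powr_diff2_def[abs_def] using assms
  by (auto intro!: derivative_eq_intros simp: algebra_simps)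

lemma continuous_on_powr_diff2:
  assumes "p > 0" "a \<ge> 1"
  shows "continuous_on {a..b} (powr_diff2 p)"
  unfolding powr_diff2_def[abs_def] using assms
  by (auto intro!: continuous_intros continuous_on_powr')

text \<open>Convexity of \<open>y powr p\<close> on y > 0. The bound on x is strict because
  \<open>0 powr p\<close> is 0 in HOL, which makes the value at x = 1 negative.\<close>

lemma powr_diff2_nonneg_neg_exponent:
  assumes "p < 0" "x > 1"
  shows "powr_diff2 p x \<ge> 0"
proof -
  have "2 * x powr p \<le> (x + 1) powr p + (x - 1) powr p"
  proof (rule midpoint_le_of_mono_deriv[where f' = "\<lambda>y. p * y powr (p - 1)"])
    show "continuous_on {x - 1..x + 1} (\<lambda>y. y powr p)"
      using assms by (auto intro!: continuous_intros)
    show "((\<lambda>y. y powr p) has_real_derivative p * y powr (p - 1)) (at y)"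
      if "x - 1 < y" for y
      using that assms by (auto intro!: derivative_eq_intros)
    show "p * y powr (p - 1) \<le> p * z powr (p - 1)" if "x - 1 < y" "y \<le> z" for y z
      using that assms by (intro mult_left_mono_neg powr_mono2') auto
  qed simp
  then show ?thesis by (simp add: powr_diff2_def)
qed

text \<open>Concavity, through the midpoint lemma for the negated power. Here x = 1 is admissible,
  as for p > 0 the power is continuous on y \<ge> 0.\<close>

lemma powr_diff2_nonpos:
  assumes "0 < p" "p < 1" "x \<ge> 1"
  shows "powr_diff2 p x \<le> 0"
proof -
  have "2 * - (x powr p) \<le> - ((x + 1) powr p) + - ((x - 1) powr p)"
  proof (rule midpoint_le_of_mono_deriv[where f' = "\<lambda>y. - (p * y powr (p - 1))"])
    show "continuous_on {x - 1..x + 1} (\<lambda>y. - (y powr p))"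
      using assms by (auto intro!: continuous_intros continuous_on_powr')
    show "((\<lambda>y. - (y powr p)) has_real_derivative - (p * y powr (p - 1))) (at y)"
      if "x - 1 < y" for y
      using that assms by (auto intro!: derivative_eq_intros)
    show "- (p * y powr (p - 1)) \<le> - (p * z powr (p - 1))" if "x - 1 < y" "y \<le> z" for y z
      using that assms by (auto intro!: mult_left_mono powr_mono2')
  qed simp
  then show ?thesis by (simp add: powr_diff2_def)
qed

lemma powr_diff2_nonneg:
  assumes "1 < p" "x \<ge> 1"
  shows "powr_diff2 p x \<ge> 0"
proof -
  have "2 * x powr p \<le> (x + 1) powr p + (x - 1) powr p"
  proof (rule midpoint_le_of_mono_deriv[where f' = "\<lambda>y. p * y powr (p - 1)"])
    show "continuous_on {x - 1..x + 1} (\<lambda>y. y powr p)"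
      using assms by (auto intro!: continuous_intros continuous_on_powr')
    show "((\<lambda>y. y powr p) has_real_derivative p * y powr (p - 1)) (at y)"
      if "x - 1 < y" for y
      using that assms by (auto intro!: derivative_eq_intros)
    show "p * y powr (p - 1) \<le> p * z powr (p - 1)" if "x - 1 < y" "y \<le> z" for y z
      using that assms by (auto intro!: mult_left_mono powr_mono2)
  qed simp
  then show ?thesis by (simp add: powr_diff2_def)
qed

text \<open>The derivative \<open>p * powr_diff2 (p - 1)\<close> is nonpositive, since p - 1 lies in
  (0, 1), where powers are concave.\<close>

lemma powr_diff2_antimono:
  assumes "1 < p" "p < 2" "1 \<le> x" "x \<le> y"
  shows "powr_diff2 p y \<le> powr_diff2 p x"
proof (cases "x = y")
  case False
  with assms have "x < y" by simp
  have "continuous_on {x..y} (powr_diff2 p)"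
    using assms by (intro continuous_on_powr_diff2) auto
  moreover have "(powr_diff2 p has_real_derivative p * powr_diff2 (p - 1) z) (at z)" if "x < z" for z
    using assms that by (intro powr_diff2_has_derivative) auto
  ultimately obtain z where z: "x < z" "z < y"
    "powr_diff2 p y - powr_diff2 p x = (y - x) * (p * powr_diff2 (p - 1) z)"
    using real_mvt[OF \<open>x < y\<close>, of "powr_diff2 p" "\<lambda>z. p * powr_diff2 (p - 1) z"] by blast
  then have "(y - x) * (p * powr_diff2 (p - 1) z) \<le> 0"
    using powr_diff2_nonpos[of "p - 1" z] assms z by (intro mult_nonneg_nonpos) auto
  then show ?thesis using z by simp
qed simp

text \<open>The derivative is nondecreasing, because differentiating once more leads to the negative
  exponent p - 2. With x \<ge> 2 the open interval stays to the right of 1.\<close>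

lemma powr_diff2_midpoint:
  assumes "1 < p" "p < 2" "x \<ge> 2"
  shows "2 * powr_diff2 p x \<le> powr_diff2 p (x + 1) + powr_diff2 p (x - 1)"
proof (rule midpoint_le_of_mono_deriv[where f' = "\<lambda>y. p * powr_diff2 (p - 1) y"])
  show "continuous_on {x - 1..x + 1} (powr_diff2 p)"
    using assms by (intro continuous_on_powr_diff2) auto
  show "(powr_diff2 p has_real_derivative p * powr_diff2 (p - 1) y) (at y)" if "x - 1 < y" for y
    using that assms by (intro powr_diff2_has_derivative) auto
  show "p * powr_diff2 (p - 1) y \<le> p * powr_diff2 (p - 1) z" if "x - 1 < y" "y \<le> z" for y z
  proof -
    have "powr_diff2 (p - 1) y \<le> powr_diff2 (p - 1) z"
    proof (rule DERIV_nonneg_imp_nondecreasing[OF \<open>y \<le> z\<close>])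
      fix t assume "y \<le> t" "t \<le> z"
      then have "t > 1" using that assms by simp
      then show "\<exists>d. (powr_diff2 (p - 1) has_real_derivative d) (at t) \<and> 0 \<le> d"
        using powr_diff2_has_derivative[of t "p - 1"] powr_diff2_nonneg_neg_exponent[of "p - 1 - 1" t] assms
        by (intro exI[of _ "(p - 1) * powr_diff2 (p - 1 - 1) t"]) simp
    qed
    then show ?thesis using assms by simp
  qed
qed simp

text \<open>The fourth difference of \<open>\<bar>x\<bar> powr s\<close> over the points -1, 0, 1, 2, 3 is
  nonnegative; this gives convexity of the kernel at its first entry.\<close>
lemma four_mult_two_powr_le:
  fixes s :: real
  assumes "s \<le> 2"
  shows "4 * 2 powr s \<le> 7 + 3 powr s"
proof -
  \<comment> \<open>At s = 2 the function is 7 - 16 + 9 = 0, so it suffices that it decreases up to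
    2.\<close>
  have "7 - 4 * 2 powr 2 + 3 powr 2 \<le> 7 - 4 * 2 powr s + 3 powr s"
  proof (rule DERIV_nonpos_imp_nonincreasing[OF assms])
    fix t :: real assume t: "s \<le> t" "t \<le> 2"
    \<comment> \<open>Since \<open>(3 / 2) powr t \<le> 9 / 4\<close> for t \<le> 2, the derivative
      is nonpositive once \<open>9 / 4 * ln 3 \<le> 4 * ln 2\<close>, which is 3 ^ 9 = 19683 \<le>
      65536 = 2 ^ 16 up to weakening.\<close>
    have "9 * ln 3 = ln ((3::real) ^ 9)" by (simp add: ln_realpow del: power_numeral)
    also have "\<dots> \<le> ln ((2::real) ^ 16)" by (subst ln_le_cancel_iff) auto
    also have "\<dots> = 16 * ln 2" by (simp add: ln_realpow del: power_numeral)
    finally have l: "9 * ln 3 \<le> 16 * ln (2::real)" .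
    have "3 powr t = 2 powr t * (3 / 2) powr t"
      by (simp add: powr_mult[symmetric])
    also have "\<dots> \<le> 2 powr t * (3 / 2) powr 2"
      using t by (intro mult_left_mono powr_mono) auto
    also have "\<dots> = 2 powr t * (9 / 4)"
      by (simp add: power2_eq_square)
    finally have "3 powr t * ln 3 \<le> 2 powr t * (9 / 4) * ln 3"
      by (intro mult_right_mono) auto
    also have "\<dots> \<le> 2 powr t * (4 * ln 2)"
      using l by (simp add: mult.assoc)
    finally have "- (4 * (2 powr t * ln 2)) + 3 powr t * ln 3 \<le> 0" by simp
    moreover have "((\<lambda>s. 7 - 4 * 2 powr s + 3 powr s) has_real_derivative
        - (4 * (2 powr t * ln 2)) + 3 powr t * ln 3) (at t)"
      by (auto intro!: derivative_eq_intros)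
    ultimately show "\<exists>d. ((\<lambda>s. 7 - 4 * 2 powr s + 3 powr s) has_real_derivative d) (at t) \<and> d \<le> 0"
      by blast
  qed
  then show ?thesis by simp
qed

section \<open>Sign, monotonicity and convexity of the coefficients G\<close>

lemma coeff_G_eq_powr_diff2:
  assumes "j \<ge> 1"
  shows "coeff_G \<alpha> j = powr_diff2 (2 - \<alpha>) (real j)"
proof -
  obtain i where "j = Suc i" using assms by (cases j) auto
  then have "real (j - 1) + 1 = real j" "real (j - 1) = real j - 1" by auto
  then show ?thesis unfolding coeff_G_def coeff_M_def powr_diff2_def by simp
qed

lemma coeff_G_nonneg: "0 < \<alpha> \<Longrightarrow> \<alpha> < 1 \<Longrightarrow> j \<ge> 1 \<Longrightarrow> coeff_G \<alpha> j \<ge> 0"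
  by (simp add: coeff_G_eq_powr_diff2 powr_diff2_nonneg)

lemma coeff_G_Suc_le: "0 < \<alpha> \<Longrightarrow> \<alpha> < 1 \<Longrightarrow> j \<ge> 1 \<Longrightarrow> coeff_G \<alpha> (Suc j) \<le> coeff_G \<alpha> j"
  by (simp add: coeff_G_eq_powr_diff2 powr_diff2_antimono)

lemma coeff_G_convex:
  assumes "0 < \<alpha>" "\<alpha> < 1" "j \<ge> 1"
  shows "2 * coeff_G \<alpha> (Suc j) \<le> coeff_G \<alpha> (Suc (Suc j)) + coeff_G \<alpha> j"
  using powr_diff2_midpoint[of "2 - \<alpha>" "real (Suc j)"] assms
  by (simp add: coeff_G_eq_powr_diff2 add.commute)

text \<open>Expanding both coefficients gives the preceding power inequality at s = 2 - \<alpha>.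
  The constant 2 is the \<beta> part of the doubled diagonal entry
  \<open>2 * (1 + \<beta>)\<close>.\<close>

lemma coeff_G_convex_start:
  assumes "0 < \<alpha>" "\<alpha> < 1"
  shows "2 * coeff_G \<alpha> 1 \<le> coeff_G \<alpha> 2 + 2"
  using four_mult_two_powr_le[of "2 - \<alpha>"] assms
  by (simp add: coeff_G_eq_powr_diff2 powr_diff2_def)

section \<open>Quadratic forms of convex Toeplitz kernels\<close>

text \<open>The conditional is the distance of i and j, written so that natural subtraction never
  truncates.\<close>

definition toeplitz_form :: "(nat \<Rightarrow> real) \<Rightarrow> nat \<Rightarrow> (nat \<Rightarrow> real) \<Rightarrow> real" where
  "toeplitz_form c n x = (\<Sum>i<n. \<Sum>j<n. c (if i \<le> j then j - i else i - j) * x i * x j)"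

lemma toeplitz_form_triangle_nonneg:
  "toeplitz_form (\<lambda>j. real (r - j)) n x \<ge> 0"
proof -
  \<comment> \<open>The kernel entry at (i, j) counts the common points of two intervals of length r,
    so it is a Gram matrix of indicator functions.\<close>
  let ?I = "\<lambda>i. {i..<i + r}"
  have card: "real (r - (if i \<le> j then j - i else i - j))
      = (\<Sum>t<n + r. indicat_real (?I i) t * indicat_real (?I j) t)" if "i < n" "j < n" for i j
  proof -
    have "(\<Sum>t<n + r. indicat_real (?I i) t * indicat_real (?I j) t)
        = (\<Sum>t<n + r. indicat_real (?I i \<inter> ?I j) t)"
      by (simp only: indicator_inter_arith)
    also have "\<dots> = real (card ({..<n + r} \<inter> (?I i \<inter> ?I j)))"
      by (simp add: indicator_def sum.If_cases Int_def)
    \<comment> \<open>The range up to n + r contains both intervals, as i, j < n. For disjoint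
      intervals both sides of the count are 0 by truncation.\<close>
    also have "{..<n + r} \<inter> (?I i \<inter> ?I j) = {max i j..<min i j + r}"
      using that by auto
    finally show ?thesis by auto
  qed
  have "toeplitz_form (\<lambda>j. real (r - j)) n x
      = (\<Sum>i<n. \<Sum>j<n. \<Sum>t<n + r. (indicator (?I i) t * x i) * (indicator (?I j) t * x j))"
    unfolding toeplitz_form_def
  proof (intro sum.cong refl)
    fix i j assume "i \<in> {..<n}" "j \<in> {..<n}"
    then show "real (r - (if i \<le> j then j - i else i - j)) * x i * x j
      = (\<Sum>t<n + r. (indicator (?I i) t * x i) * (indicator (?I j) t * x j))"
      by (subst card) (simp_all only: lessThan_iff sum_distrib_left sum_distrib_right mult_ac)
  qed
  also have "\<dots> = (\<Sum>i<n. \<Sum>t<n + r. \<Sum>j<n. (indicator (?I i) t * x i) * (indicator (?I j) t * x j))"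
    by (rule sum.cong[OF refl], rule sum.swap)
  also have "\<dots> = (\<Sum>t<n + r. \<Sum>i<n. \<Sum>j<n. (indicator (?I i) t * x i) * (indicator (?I j) t * x j))"
    by (rule sum.swap)
  also have "\<dots> = (\<Sum>t<n + r. (\<Sum>i<n. indicator (?I i) t * x i)\<^sup>2)"
    by (simp only: power2_eq_square sum_product)
  finally show ?thesis by (simp add: sum_nonneg)
qed

text \<open>Summing by parts twice writes c as a combination of truncated triangles, weighted by its
  second differences, plus a last triangle and a constant.\<close>

lemma convex_seq_decomposition:
  fixes c :: "nat \<Rightarrow> real"
  assumes "j \<le> n"
  shows "c j = (\<Sum>r<n. (c r - 2 * c (Suc r) + c (Suc (Suc r))) * real (Suc r - j))
    + (c n - c (Suc n)) * real (Suc n - j) + c (Suc n)"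
  using assms
proof (induction n rule: dec_induct)
  case base
  \<comment> \<open>For r < j the truncated \<open>Suc r - j\<close> is 0.\<close>
  have "(\<Sum>r<j. (c r - 2 * c (Suc r) + c (Suc (Suc r))) * real (Suc r - j)) = 0"
    by (intro sum.neutral) auto
  then show ?case by simp
next
  case (step n)
  then show ?case by (simp add: Suc_diff_le of_nat_diff algebra_simps)
qed

text \<open>A discrete Polya criterion: the kernel is a nonnegative combination of triangles, whose
  forms are nonnegative, and of a constant, whose form is the square of the sum of x.\<close>

lemma toeplitz_form_convex_nonneg:
  assumes convex: "\<And>r. c r - 2 * c (Suc r) + c (Suc (Suc r)) \<ge> 0"
    and decr: "c (Suc n) \<le> c n" and nonneg: "c (Suc n) \<ge> 0"
  shows "toeplitz_form c n x \<ge> 0"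
proof -
  let ?T = "\<lambda>r. toeplitz_form (\<lambda>j. real (r - j)) n x"
  let ?d = "\<lambda>i j::nat. if i \<le> j then j - i else i - j"
  let ?l = "\<lambda>r. c r - 2 * c (Suc r) + c (Suc (Suc r))"
  have "toeplitz_form c n x = (\<Sum>i<n. \<Sum>j<n.
      (\<Sum>r<n. ?l r * (real (Suc r - ?d i j) * x i * x j))
      + (c n - c (Suc n)) * (real (Suc n - ?d i j) * x i * x j) + c (Suc n) * (x i * x j))"
    unfolding toeplitz_form_def
  proof (intro sum.cong refl)
    fix i j assume "i \<in> {..<n}" "j \<in> {..<n}"
    then have "?d i j \<le> n" by auto
    from convex_seq_decomposition[OF this, of c]
    have "c (?d i j) * x i * x j = ((\<Sum>r<n. ?l r * real (Suc r - ?d i j))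
      + (c n - c (Suc n)) * real (Suc n - ?d i j) + c (Suc n)) * (x i * x j)"
      by (metis mult.assoc)
    then show "c (?d i j) * x i * x j = (\<Sum>r<n. ?l r * (real (Suc r - ?d i j) * x i * x j))
      + (c n - c (Suc n)) * (real (Suc n - ?d i j) * x i * x j) + c (Suc n) * (x i * x j)"
      by (simp only: distrib_right sum_distrib_right mult.assoc)
  qed
  also have "\<dots> = (\<Sum>i<n. \<Sum>j<n. \<Sum>r<n. ?l r * (real (Suc r - ?d i j) * x i * x j))
      + (c n - c (Suc n)) * ?T (Suc n) + c (Suc n) * (\<Sum>i<n. x i)\<^sup>2"
    unfolding toeplitz_form_def power2_eq_square sum_product
    by (simp only: sum.distrib sum_distrib_left)
  also have "(\<Sum>i<n. \<Sum>j<n. \<Sum>r<n. ?l r * (real (Suc r - ?d i j) * x i * x j))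
      = (\<Sum>i<n. \<Sum>r<n. \<Sum>j<n. ?l r * (real (Suc r - ?d i j) * x i * x j))"
    by (rule sum.cong[OF refl], rule sum.swap)
  also have "\<dots> = (\<Sum>r<n. \<Sum>i<n. \<Sum>j<n. ?l r * (real (Suc r - ?d i j) * x i * x j))"
    by (rule sum.swap)
  also have "\<dots> = (\<Sum>r<n. ?l r * ?T (Suc r))"
    unfolding toeplitz_form_def by (simp only: sum_distrib_left)
  finally have eq: "toeplitz_form c n x = (\<Sum>r<n. ?l r * ?T (Suc r))
      + (c n - c (Suc n)) * ?T (Suc n) + c (Suc n) * (\<Sum>i<n. x i)\<^sup>2" .
  show ?thesis
    unfolding eq using decr nonneg
    by (intro add_nonneg_nonneg[OF add_nonneg_nonneg] sum_nonneg mult_nonneg_nonneg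
      convex toeplitz_form_triangle_nonneg) auto
qed

text \<open>The symmetric form meets each off-diagonal pair twice but each diagonal entry once,
  hence the doubled entry at 0.\<close>

lemma toeplitz_form_eq_causal:
  fixes a x :: "nat \<Rightarrow> real"
  shows "toeplitz_form (\<lambda>j. if j = 0 then 2 * a 0 else a j) n x
    = 2 * (\<Sum>k<n. \<Sum>m\<le>k. a (k - m) * (x k * x m))"
proof (induction n)
  case (Suc n)
  let ?c = "\<lambda>j. if j = 0 then 2 * a 0 else a j"
  have 1: "(\<Sum>i<n. ?c (if i \<le> n then n - i else i - n) * x i * x n)
      = (\<Sum>m<n. a (n - m) * (x n * x m))"
    by (intro sum.cong) (auto simp: mult_ac)
  have 2: "(\<Sum>j<n. ?c (if n \<le> j then j - n else n - j) * x n * x j)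
      = (\<Sum>m<n. a (n - m) * (x n * x m))"
    by (intro sum.cong) (auto simp: mult_ac)
  have "toeplitz_form ?c (Suc n) x = toeplitz_form ?c n x
      + (\<Sum>i<n. ?c (if i \<le> n then n - i else i - n) * x i * x n)
      + (\<Sum>j<n. ?c (if n \<le> j then j - n else n - j) * x n * x j) + 2 * a 0 * (x n * x n)"
    unfolding toeplitz_form_def by (simp add: sum.distrib)
  also have "\<dots> = toeplitz_form ?c n x + 2 * (\<Sum>m\<le>n. a (n - m) * (x n * x m))"
    unfolding 1 2 by (simp add: lessThan_Suc_atMost[symmetric])
  finally show ?case using Suc.IH by simp
qed (simp add: toeplitz_form_def)

section \<open>Discrete Laplacian and Poisson problem\<close>

definition laplacian :: "(nat \<Rightarrow> real) \<Rightarrow> nat \<Rightarrow> real" where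
  "laplacian u i = u (Suc i) - 2 * u i + u (i - 1)"

lemma sum_mult_laplacian:
  fixes u v :: "nat \<Rightarrow> real"
  assumes "u 0 = 0" "u M = 0" "M > 0"
  shows "(\<Sum>i=1..<M. u i * laplacian v i) = - (\<Sum>i<M. (u (Suc i) - u i) * (v (Suc i) - v i))"
proof -
  \<comment> \<open>Without a condition at the right end a boundary term remains; at
    \<open>Suc n = M\<close> it vanishes with \<open>u M\<close>.\<close>
  have "(\<Sum>i=1..<Suc n. u i * laplacian v i)
      = u (Suc n) * (v (Suc n) - v n) - (\<Sum>i<Suc n. (u (Suc i) - u i) * (v (Suc i) - v i))" for n
    by (induction n) (simp_all add: assms(1) laplacian_def algebra_simps)
  from this[of "M - 1"] show ?thesis using assms by simp
qed

lemma laplacian_symmetric: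
  assumes "u 0 = 0" "u M = 0" "v 0 = 0" "v M = 0" "M > 0"
  shows "(\<Sum>i=1..<M. u i * laplacian v i) = (\<Sum>i=1..<M. v i * laplacian u i)"
  unfolding sum_mult_laplacian[OF assms(1,2,5)] sum_mult_laplacian[OF assms(3,4,5)]
  by (simp only: mult.commute)

lemma discrete_poisson_solvable:
  fixes d :: "nat \<Rightarrow> real"
  assumes "M > 0"
  obtains w where "w 0 = 0" "w M = 0" "\<And>i. i \<ge> 1 \<Longrightarrow> laplacian w i = - d i"
proof -
  \<comment> \<open>The solution is a linear function minus the double sum of d; its slope c is the
    mean of p, which forces \<open>w M = 0\<close>.\<close>
  define p where "p i = (\<Sum>l=1..i. d l)" for i
  define c where "c = (\<Sum>m<M. p m) / real M"
  define w where "w i = c * real i - (\<Sum>m<i. p m)" for i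
  show ?thesis
  proof
    show "w 0 = 0" by (simp add: w_def)
    show "w M = 0" using assms by (simp add: w_def c_def)
    show "laplacian w i = - d i" if "i \<ge> 1" for i
    proof -
      obtain j where "i = Suc j" using \<open>i \<ge> 1\<close> by (cases i) auto
      then show ?thesis by (simp add: laplacian_def w_def p_def algebra_simps)
    qed
  qed
qed

section \<open>Energy estimate\<close>

text \<open>Testing with the increments themselves would telescope the gradient norm of E; the
  inverse Laplacian in the test function yields the plain square norm.\<close>

lemma causal_diffusion_stable:
  fixes E :: "nat \<Rightarrow> nat \<Rightarrow> real" and a :: "nat \<Rightarrow> real"
  assumes "M > 0" "\<mu> > 0"
    and pos: "\<And>x. (\<Sum>k<n. \<Sum>m\<le>k. a (k - m) * (x k * x m)) \<ge> 0"
    and bd: "\<And>k. k \<le> n \<Longrightarrow> E k 0 = 0 \<and> E k M = 0"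
    and eq: "\<And>k i. k < n \<Longrightarrow> i \<in> {1..<M} \<Longrightarrow>
      (\<Sum>m\<le>k. a (k - m) * (E (Suc m) i - E m i)) = \<mu> * laplacian (\<lambda>i. E (Suc k) i + E k i) i"
  shows "(\<Sum>i=1..<M. (E n i)\<^sup>2) \<le> (\<Sum>i=1..<M. (E 0 i)\<^sup>2)"
proof -
  define d where "d k i = E (Suc k) i - E k i" for k i
  have "\<exists>w. w 0 = 0 \<and> w M = 0 \<and> (\<forall>i\<ge>1. laplacian w i = - d k i)" for k
    using discrete_poisson_solvable[OF \<open>M > 0\<close>, of "d k"] by metis
  then obtain w where w: "\<And>k. w k 0 = 0" "\<And>k. w k M = 0"
    "\<And>k i. i \<ge> 1 \<Longrightarrow> laplacian (w k) i = - d k i" by metis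
  \<comment> \<open>Node first, time second: \<open>g i\<close> is then a time sequence to which
    \<open>pos\<close> applies.\<close>
  define g where "g i k = w k (Suc i) - w k i" for i k
  have wd: "(\<Sum>i=1..<M. w k i * d m i) = (\<Sum>i<M. g i k * g i m)" for k m
  proof -
    have "(\<Sum>i=1..<M. w k i * d m i) = - (\<Sum>i=1..<M. w k i * laplacian (w m) i)"
      by (simp add: w(3) sum_negf)
    then show ?thesis
      unfolding sum_mult_laplacian[OF w(1,2) \<open>M > 0\<close>] by (simp add: g_def)
  qed
  have energy: "(\<Sum>m\<le>k. a (k - m) * (\<Sum>i<M. g i k * g i m))
      = \<mu> * ((\<Sum>i=1..<M. (E k i)\<^sup>2) - (\<Sum>i=1..<M. (E (Suc k) i)\<^sup>2))" if "k < n" for k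
  proof -
    let ?Y = "\<lambda>i. E (Suc k) i + E k i"
    have "(\<Sum>m\<le>k. a (k - m) * (\<Sum>i<M. g i k * g i m))
        = (\<Sum>m\<le>k. \<Sum>i=1..<M. a (k - m) * (w k i * d m i))"
      by (simp only: wd[symmetric] sum_distrib_left)
    also have "\<dots> = (\<Sum>i=1..<M. \<Sum>m\<le>k. a (k - m) * (w k i * d m i))"
      by (rule sum.swap)
    also have "\<dots> = (\<Sum>i=1..<M. w k i * (\<Sum>m\<le>k. a (k - m) * d m i))"
      by (simp add: sum_distrib_left mult_ac)
    also have "\<dots> = (\<Sum>i=1..<M. w k i * (\<mu> * laplacian ?Y i))"
      using eq[OF that] by (intro sum.cong) (auto simp: d_def)
    also have "\<dots> = \<mu> * (\<Sum>i=1..<M. w k i * laplacian ?Y i)"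
      by (simp add: sum_distrib_left mult_ac)
    \<comment> \<open>Moved onto \<open>w k\<close>, the Laplacian gives \<open>- d k\<close>, and
      the product of sum and negated increment is a difference of squares.\<close>
    also have "(\<Sum>i=1..<M. w k i * laplacian ?Y i) = (\<Sum>i=1..<M. ?Y i * laplacian (w k) i)"
      using w bd that \<open>M > 0\<close> by (intro laplacian_symmetric) auto
    also have "\<dots> = (\<Sum>i=1..<M. (E k i)\<^sup>2 - (E (Suc k) i)\<^sup>2)"
      by (intro sum.cong) (auto simp: w(3) d_def algebra_simps power2_eq_square)
    finally show ?thesis by (simp add: sum_subtractf)
  qed
  \<comment> \<open>Nonnegativity is used at each node for the total over k < n, so level n is
    compared directly with level 0.\<close>
  have "0 \<le> (\<Sum>i<M. \<Sum>k<n. \<Sum>m\<le>k. a (k - m) * (g i k * g i m))"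
    by (intro sum_nonneg pos)
  also have "\<dots> = (\<Sum>k<n. \<Sum>i<M. \<Sum>m\<le>k. a (k - m) * (g i k * g i m))"
    by (rule sum.swap)
  also have "\<dots> = (\<Sum>k<n. \<Sum>m\<le>k. \<Sum>i<M. a (k - m) * (g i k * g i m))"
    by (rule sum.cong[OF refl], rule sum.swap)
  also have "\<dots> = (\<Sum>k<n. \<mu> * ((\<Sum>i=1..<M. (E k i)\<^sup>2) - (\<Sum>i=1..<M. (E (Suc k) i)\<^sup>2)))"
    using energy by (intro sum.cong) (auto simp: sum_distrib_left[symmetric])
  also have "\<dots> = \<mu> * ((\<Sum>i=1..<M. (E 0 i)\<^sup>2) - (\<Sum>i=1..<M. (E n i)\<^sup>2))"
    by (simp only: sum_distrib_left[symmetric] sum_lessThan_telescope'[where f = "\<lambda>k. \<Sum>i=1..<M. (E k i)\<^sup>2"])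
  finally show ?thesis using \<open>\<mu> > 0\<close> by (simp add: zero_le_mult_iff)
qed

section \<open>The scheme as a convolution of increments\<close>

text \<open>Abel summation: interior levels collect two neighbouring weights, while the last and the
  first level keep only \<open>G 1\<close> and \<open>G k\<close>.\<close>

lemma sum_by_parts_causal:
  fixes G e :: "nat \<Rightarrow> real"
  assumes "k \<ge> 1"
  shows "(\<Sum>m<k. G (k - m) * (e (Suc m) - e m))
    = G 1 * e k - (\<Sum>j=1..k - 1. (G (k - j) - G (k - j + 1)) * e j) - G k * e 0"
proof -
  obtain p where k: "k = Suc p" using assms by (cases k) auto
  have 1: "(\<Sum>m<k. G (k - m) * e (Suc m)) = (\<Sum>j=1..p. G (k - j + 1) * e j) + G 1 * e k"
  proof -
    have "(\<Sum>m<k. G (k - m) * e (Suc m)) = (\<Sum>m<p. G (k - m) * e (Suc m)) + G 1 * e k"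
      by (simp add: k)
    also have "(\<Sum>m<p. G (k - m) * e (Suc m)) = (\<Sum>j=1..p. G (k - j + 1) * e j)"
      by (rule sum.reindex_bij_witness[of _ "\<lambda>j. j - 1" Suc]) (auto simp: k Suc_diff_le)
    finally show ?thesis .
  qed
  have 2: "(\<Sum>m<k. G (k - m) * e m) = (\<Sum>j=1..p. G (k - j) * e j) + G k * e 0"
    unfolding k sum.lessThan_Suc_shift
    by (simp, rule sum.reindex_bij_witness[of _ "\<lambda>j. j - 1" Suc]) (auto simp: k)
  have "(\<Sum>m<k. G (k - m) * (e (Suc m) - e m))
      = (\<Sum>m<k. G (k - m) * e (Suc m)) - (\<Sum>m<k. G (k - m) * e m)"
    by (simp add: right_diff_distrib sum_subtractf)
  then show ?thesis
    unfolding 1 2 by (simp add: k left_diff_distrib sum_subtractf)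
qed

text \<open>Entry 0 weighs the newest increment: 1 from the time derivative, \<beta> from the Caputo
  term. It is set apart because \<open>coeff_G \<alpha> 0\<close> is 0 by truncated
  subtraction.\<close>

definition memory_kernel :: "real \<Rightarrow> real \<Rightarrow> nat \<Rightarrow> real" where
  "memory_kernel \<alpha> \<beta> j = (if j = 0 then 1 + \<beta> else \<beta> * coeff_G \<alpha> j)"

lemma memory_kernel_positive:
  assumes "0 < \<alpha>" "\<alpha> < 1" "\<beta> \<ge> 0"
  shows "(\<Sum>k<n. \<Sum>m\<le>k. memory_kernel \<alpha> \<beta> (k - m) * (x k * x m)) \<ge> 0"
proof (cases "n = 0")
  case False
  let ?c = "\<lambda>j. if j = 0 then 2 * memory_kernel \<alpha> \<beta> 0 else memory_kernel \<alpha> \<beta> j"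
  have "toeplitz_form ?c n x \<ge> 0"
  proof (rule toeplitz_form_convex_nonneg)
    fix r show "?c r - 2 * ?c (Suc r) + ?c (Suc (Suc r)) \<ge> 0"
    proof (cases r)
      case 0
      \<comment> \<open>The \<beta> part of the second difference at 0 is nonnegative by this; the
        rest of the doubled entry adds 2.\<close>
      have "\<beta> * (2 * coeff_G \<alpha> 1) \<le> \<beta> * (coeff_G \<alpha> 2 + 2)"
        using coeff_G_convex_start[of \<alpha>] assms by (intro mult_left_mono) auto
      then show ?thesis using 0 by (simp add: memory_kernel_def algebra_simps numeral_2_eq_2)
    next
      case (Suc j)
      have "\<beta> * (2 * coeff_G \<alpha> (Suc r)) \<le> \<beta> * (coeff_G \<alpha> (Suc (Suc r)) + coeff_G \<alpha> r)"
        using coeff_G_convex[of \<alpha> r] assms Suc by (intro mult_left_mono) auto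
      then show ?thesis using Suc by (simp add: memory_kernel_def algebra_simps)
    qed
  next
    \<comment> \<open>As n is not 0, both indices lie beyond the doubled entry.\<close>
    show "?c (Suc n) \<le> ?c n"
      using False assms by (simp add: memory_kernel_def mult_left_mono coeff_G_Suc_le)
    show "?c (Suc n) \<ge> 0"
      using assms by (simp add: memory_kernel_def coeff_G_nonneg)
  qed
  then show ?thesis unfolding toeplitz_form_eq_causal by simp
qed simp

lemma cn_scheme_difference:
  assumes "cn_scheme \<alpha> L T M N f \<psi> U" "cn_scheme \<alpha> L T M N f \<psi> V"
    and E: "\<And>k i. E k i = U k i - V k i"
    and k: "k < N" and i: "i \<in> {1..<M}"
  shows "(\<Sum>m\<le>k. memory_kernel \<alpha> (coeff_beta \<alpha> (T / N)) (k - m) * (E (Suc m) i - E m i))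
    = T / N / (2 * (L / M)\<^sup>2) * laplacian (\<lambda>i. E (Suc k) i + E k i) i"
proof -
  define \<tau> where "\<tau> = T / real N"
  define \<mu> where "\<mu> = \<tau> / (2 * (L / real M)\<^sup>2)"
  define \<beta> where "\<beta> = coeff_beta \<alpha> \<tau>"
  define G where "G = coeff_G \<alpha>"
  define S where "S W = (\<Sum>j=1..k - 1. (G (k - j) - G (k - j + 1)) * W j i)" for W :: "nat \<Rightarrow> nat \<Rightarrow> real"
  have \<mu>2: "\<tau> / (L / real M)\<^sup>2 = 2 * \<mu>" by (simp add: \<mu>_def)
  have i': "i \<in> {1..M - 1}" using i by auto
  \<comment> \<open>All data terms; they do not depend on the solution and cancel in the
    difference.\<close>
  define R where "R = \<tau> * \<beta> * coeff_M \<alpha> k * \<psi> (real i * (L / real M))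
      + \<tau> * f (real i * (L / real M)) ((real k + 1 / 2) * \<tau>)
      - \<tau> * \<psi> (real i * (L / real M)) * ((real k + 1 / 2) * \<tau>) powr (1 - \<alpha>) / Gamma (2 - \<alpha>)"
  have scheme: "- \<mu> * W (k + 1) (i + 1) + (2 * \<mu> + 1 + \<beta>) * W (k + 1) i - \<mu> * W (k + 1) (i - 1)
      = \<mu> * W k (i + 1) + (- (2 * \<mu>) + 1 + \<beta> - \<beta> * G 1 * of_bool (k \<ge> 1)) * W k i
        + \<mu> * W k (i - 1) + \<beta> * S W + \<beta> * G k * W 0 i * of_bool (k \<ge> 1) + R"
    if "cn_scheme \<alpha> L T M N f \<psi> W" for W
    using that k i' unfolding cn_scheme_def Let_def \<tau>_def[symmetric] \<mu>_def[symmetric] \<mu>2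
      \<beta>_def[symmetric] G_def[symmetric] S_def R_def by (auto simp: algebra_simps)
  have S: "S E = S U - S V"
    by (simp add: S_def E right_diff_distrib sum_subtractf)
  have diff: "(1 + \<beta>) * (E (Suc k) i - E k i)
      + of_bool (k \<ge> 1) * \<beta> * (G 1 * E k i - G k * E 0 i) - \<beta> * S E
      = \<mu> * laplacian (\<lambda>i. E (Suc k) i + E k i) i"
    using scheme[OF assms(1)] scheme[OF assms(2)]
    unfolding laplacian_def S E by (simp add: algebra_simps)
  \<comment> \<open>For k = 0 both sides are 0: the sums are empty and \<open>of_bool\<close>
    vanishes.\<close>
  have mem: "(\<Sum>m<k. memory_kernel \<alpha> \<beta> (k - m) * (E (Suc m) i - E m i))
      = of_bool (k \<ge> 1) * \<beta> * (G 1 * E k i - G k * E 0 i) - \<beta> * S E"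
  proof (cases "k = 0")
    case False
    have "(\<Sum>m<k. memory_kernel \<alpha> \<beta> (k - m) * (E (Suc m) i - E m i))
        = \<beta> * (\<Sum>m<k. G (k - m) * (E (Suc m) i - E m i))"
      by (simp add: sum_distrib_left memory_kernel_def G_def mult_ac)
    also have "\<dots> = \<beta> * (G 1 * E k i - S E - G k * E 0 i)"
      using sum_by_parts_causal[of k G "\<lambda>k. E k i"] False by (simp add: S_def)
    finally show ?thesis using False by (simp add: algebra_simps)
  qed (simp add: S_def)
  have "(\<Sum>m\<le>k. memory_kernel \<alpha> \<beta> (k - m) * (E (Suc m) i - E m i))
      = (1 + \<beta>) * (E (Suc k) i - E k i)
        + (\<Sum>m<k. memory_kernel \<alpha> \<beta> (k - m) * (E (Suc m) i - E m i))"
    by (simp add: lessThan_Suc_atMost[symmetric] memory_kernel_def)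
  with mem diff show ?thesis
    unfolding \<tau>_def[symmetric] \<mu>_def[symmetric] \<beta>_def[symmetric] by linarith
qed

theorem theorem10:
  fixes \<alpha> L T :: real and M N :: nat
    and f :: "real \<Rightarrow> real \<Rightarrow> real" and \<psi> :: "real \<Rightarrow> real"
    and U V :: "nat \<Rightarrow> nat \<Rightarrow> real"
  assumes "0 < \<alpha>" and "\<alpha> < 1" and "L > 0" and "T > 0" and "M > 0" and "N > 0"
    and "cn_scheme \<alpha> L T M N f \<psi> U"
    and "cn_scheme \<alpha> L T M N f \<psi> V"
  shows "\<forall>k\<in>{1..N}. grid_norm (L / real M) M (\<lambda>i. U k i - V k i)
                    \<le> grid_norm (L / real M) M (\<lambda>i. U 0 i - V 0 i)"
proof
  fix n assume n: "n \<in> {1..N}"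
  let ?E = "\<lambda>k i. U k i - V k i"
  have \<beta>: "coeff_beta \<alpha> (T / N) \<ge> 0"
    using assms by (simp add: coeff_beta_def Gamma_real_pos less_imp_le)
  have "(\<Sum>i=1..<M. (?E n i)\<^sup>2) \<le> (\<Sum>i=1..<M. (?E 0 i)\<^sup>2)"
  proof (rule causal_diffusion_stable)
    show "T / N / (2 * (L / M)\<^sup>2) > 0" using assms by simp
    show "(\<Sum>k<n. \<Sum>m\<le>k. memory_kernel \<alpha> (coeff_beta \<alpha> (T / N)) (k - m) * (x k * x m)) \<ge> 0" for x
      using assms \<beta> by (intro memory_kernel_positive) auto
    show "?E k 0 = 0 \<and> ?E k M = 0" if "k \<le> n" for k
      using assms(7,8) that n by (auto simp: cn_scheme_def Let_def)
    show "(\<Sum>m\<le>k. memory_kernel \<alpha> (coeff_beta \<alpha> (T / N)) (k - m) * (?E (Suc m) i - ?E m i))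
      = T / N / (2 * (L / M)\<^sup>2) * laplacian (\<lambda>i. ?E (Suc k) i + ?E k i) i"
      if "k < n" "i \<in> {1..<M}" for k i
      using cn_scheme_difference[OF assms(7,8), of ?E k i] that n by simp
  qed (rule \<open>M > 0\<close>)
  moreover have "{1..M - 1} = {1..<M}" using \<open>M > 0\<close> by auto
  ultimately show "grid_norm (L / real M) M (?E n) \<le> grid_norm (L / real M) M (?E 0)"
    unfolding grid_norm_def sum_distrib_left[symmetric] using \<open>L > 0\<close>
    by (intro real_sqrt_le_mono mult_left_mono) simp_all
qed

end
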